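(* Let $a,b>0$ and $0<\beta\le1$ be constants and consider the rates $a(x)=a$, $b(x)=bx^\beta$ for $x\ge0$, and $\mathfrak n(z)=z^{i_0}$ with $i_0\ge1$ an integer. Let $\rho>0$, let $0\le f^{\rm in}\in L^1(\mathbb R_+,(1+x)dx)$ with $\int_0^\infty x^2f^{\rm in}(x)\,dx<\infty$, and let $f$ be a global solution of the Lifshitz--Slyozov equation with nucleation with these rates and data $f^{\rm in}$ and $\rho$. Set $M_0(t)=\int_0^\infty f(t,x)\,dx$ and $u(t)=\rho-\int_0^\infty xf(t,x)\,dx$. Then there exists $C>0$ such that, for all sufficiently large $t$, $$M_0(t)\le C\,t^{\frac1{1+i_0\beta}},\qquad u(t)\le C\,t^{-\frac{\beta}{1+i_0\beta}} .$$
   Context: $\mathbb R_+=(0,\infty)$. $L^1(\mathbb R_+,(1+x)dx)$ is the space of functions integrable with respect to the measure $(1+x)dx$; $\mathcal C([0,\infty),w\text{-}L^1(\mathbb R_+,(1+x)dx))$ is the set of maps $f$ from $[0,\infty)$ to this space such that $t\mapsto\int_0^\infty f(t,x)\varphi(x)(1+x)\,dx$ is continuous for every $\varphi\in L^\infty(0,\infty)$. Global solution (for these rates $\Phi(x)=b(x)/a(x)=\frac ba x^{\beta}$ and $\Phi_0=\lim_{x\to0^+}\Phi(x)=0$): given $0\le f^{\rm in}\in L^1(\mathbb R_+,(1+x)dx)$ and $\rho>0$, a function $0\le f\in\mathcal C([0,\infty),w\text{-}L^1(\mathbb R_+,(1+x)dx))$ is a global solution of the Lifshitz--Slyozov equation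 with nucleation if, with $u(t):=\rho-\int_0^\infty xf(t,x)\,dx$: (1) for all $t\ge0$ and every $\varphi\in\mathcal C^0([0,\infty))$ with $\varphi'\in L^\infty(0,\infty)$, $$\int_0^\infty\varphi(x)f(t,x)\,dx=\int_0^\infty\varphi(x)f^{\rm in}(x)\,dx+\int_0^t\!\int_0^\infty(a(x)u(s)-b(x))\varphi'(x)f(s,x)\,dx\,ds+\int_0^t\varphi(0)\,\mathfrak n(u(s))\,ds;$$ (2) $u(t)>0$ for all $t\ge0$. *)

theory Defs
  imports "HOL-Analysis.Analysis"
begin

text \<open>
  Elements of the Lebesgue spaces on \<open>(0,\<infinity>)\<close> are represented by functions on \<open>real\<close> of which only
  the values on \<open>{0<..}\<close>, up to null sets, matter. Likewise, for time-dependent functions only the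
  times \<open>t \<ge> 0\<close> matter.
\<close>

definition weighted_L1 :: "(real \<Rightarrow> real) set" where
  "weighted_L1 = {g. set_integrable lebesgue {0<..} (\<lambda>x. (1 + x) * g x)}"

definition Linf_pos :: "(real \<Rightarrow> real) set" where
  "Linf_pos = {g. set_borel_measurable lebesgue {0<..} g \<and>
     (\<exists>K. AE x in lebesgue. x > 0 \<longrightarrow> \<bar>g x\<bar> \<le> K)}"

definition nonneg_ae :: "(real \<Rightarrow> real) \<Rightarrow> bool" where
  "nonneg_ae g \<longleftrightarrow> (AE x in lebesgue. x > 0 \<longrightarrow> g x \<ge> 0)"

definition weakly_continuous_L1 :: "(real \<Rightarrow> real \<Rightarrow> real) \<Rightarrow> bool" where
  "weakly_continuous_L1 f \<longleftrightarrow>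
     (\<forall>t\<ge>0. f t \<in> weighted_L1) \<and>
     (\<forall>\<phi>\<in>Linf_pos. continuous_on {0..}
        (\<lambda>t. LINT x:{0<..}|lebesgue. f t x * \<phi> x * (1 + x)))"

definition smooth_compact_support :: "(real \<Rightarrow> real) \<Rightarrow> bool" where
  "smooth_compact_support \<psi> \<longleftrightarrow>
     (\<forall>n x. ((deriv ^^ n) \<psi>) differentiable (at x)) \<and>
     compact (closure {x. \<psi> x \<noteq> 0}) \<and> closure {x. \<psi> x \<noteq> 0} \<subseteq> {0<..}"

text \<open>
  The derivative of a test function is taken in the sense of distributions on \<open>(0,\<infinity>)\<close>. (An
  almost everywhere derivative would be too weak: it would admit Cantor's function with
  derivative \<open>0\<close>.)
\<close>

definition weak_derivative :: "(real \<Rightarrow> real) \<Rightarrow> (real \<Rightarrow> real) \<Rightarrow> bool" where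
  "weak_derivative \<phi> d\<phi> \<longleftrightarrow>
     (\<forall>\<psi>. smooth_compact_support \<psi> \<longrightarrow>
        (LINT x:{0<..}|lebesgue. \<phi> x * deriv \<psi> x) =
          - (LINT x:{0<..}|lebesgue. d\<phi> x * \<psi> x))"

definition M0 :: "(real \<Rightarrow> real \<Rightarrow> real) \<Rightarrow> real \<Rightarrow> real" where
  "M0 f t = (LINT x:{0<..}|lebesgue. f t x)"

definition monomer :: "real \<Rightarrow> (real \<Rightarrow> real \<Rightarrow> real) \<Rightarrow> real \<Rightarrow> real" where
  "monomer \<rho> f t = \<rho> - (LINT x:{0<..}|lebesgue. x * f t x)"

text \<open>
  Global solutions for rates \<open>a\<close>, \<open>b\<close> and nucleation rate \<open>nuc\<close>. In general the last condition reads
  \<open>u(t) > \<Phi>\<^sub>0\<close> with \<open>\<Phi>\<^sub>0\<close> the limit of \<open>b(x)/a(x)\<close> as \<open>x\<close> tends to \<open>0\<close> from the right; the definition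
  is meant for rates with \<open>\<Phi>\<^sub>0 = 0\<close>.
\<close>

definition global_solution ::
  "(real \<Rightarrow> real) \<Rightarrow> (real \<Rightarrow> real) \<Rightarrow> (real \<Rightarrow> real) \<Rightarrow> (real \<Rightarrow> real) \<Rightarrow> real
     \<Rightarrow> (real \<Rightarrow> real \<Rightarrow> real) \<Rightarrow> bool" where
  "global_solution a b nuc f_in \<rho> f \<longleftrightarrow>
     weakly_continuous_L1 f \<and>
     (\<forall>t\<ge>0. nonneg_ae (f t)) \<and>
     (\<forall>t\<ge>0. \<forall>\<phi> d\<phi>. continuous_on {0..} \<phi> \<and> d\<phi> \<in> Linf_pos \<and> weak_derivative \<phi> d\<phi> \<longrightarrow>
        (LINT x:{0<..}|lebesgue. \<phi> x * f t x) =
          (LINT x:{0<..}|lebesgue. \<phi> x * f_in x)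
          + (LINT s:{0..t}|lebesgue. LINT x:{0<..}|lebesgue.
               (a x * monomer \<rho> f s - b x) * d\<phi> x * f s x)
          + (LINT s:{0..t}|lebesgue. \<phi> 0 * nuc (monomer \<rho> f s))) \<and>
     (\<forall>t\<ge>0. monomer \<rho> f t > 0)"

end

theory Submission imports Defs begin

text \<open>
  Write \<open>N = M\<^sub>0\<close>, so \<open>N' = u ^ i\<^sub>0\<close> and \<open>u' = b M\<^sub>\<beta> - a u N\<close>, where \<open>M\<^sub>\<beta> \<le> (1 + \<rho>) N\<^bsup>1-\<beta>\<^esup>\<close> by interpolation.

  Lower bound for \<open>N\<close>. With \<open>U\<close> the integral of \<open>u\<close> over \<open>[0, T]\<close>, the time integral of \<open>M\<^sub>\<beta>\<close> is
  controlled by \<open>1 + N(T) U\<close> through the equation for \<open>u\<close>, and that of \<open>M\<^bsub>1+\<beta>\<^esub>\<close> by \<open>1 + U\<close> through the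
  equation for the second moment. Interpolating the mass \<open>\<rho> - u\<close> between the two at the length
  scale \<open>1 / N(T)\<close> gives \<open>\<rho> T \<le> C N(T)\<^bsup>\<beta>\<^esup> (1 + U)\<close>; since \<open>u ^ i\<^sub>0\<close> integrates to at most \<open>N(T)\<close>, this forces
  \<open>N(T) powr (1 + i\<^sub>0 \<beta>) \<ge> c T\<close>.

  Upper bounds. The product \<open>w = N\<^bsup>\<beta>\<^esup> u\<close> satisfies \<open>w' \<le> N (B - a w / 2)\<close> once \<open>N\<close> is large, hence stays
  bounded. Then \<open>(N powr (1 + i\<^sub>0 \<beta>))' = (1 + i\<^sub>0 \<beta>) w ^ i\<^sub>0\<close> is bounded, and \<open>u = w N\<^bsup>-\<beta>\<^esup>\<close> is estimated by the lower
  bound for \<open>N\<close>.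
\<close>

section \<open>Weights of linear growth: integrability and continuity in time\<close>

text \<open>Writing \<open>g * h\<close> as \<open>g / (1 + x)\<close> times
  \<open>(1 + x) * h\<close> gives both measurability and the bound, since \<open>h\<close> is known
  to be measurable only through this weighted product on the half-line.\<close>

lemma weighted_L1_integrable:
  assumes h: "h \<in> weighted_L1" and g: "g \<in> borel_measurable borel"
    and bd: "\<And>x. x > 0 \<Longrightarrow> \<bar>g x\<bar> \<le> K * (1 + x)"
  shows "set_integrable lebesgue {0<..} (\<lambda>x. g x * h x)"
proof -
  have int: "integrable lebesgue (\<lambda>x. indicator {0<..} x * ((1 + x) * h x))"
    using h by (simp add: weighted_L1_def set_integrable_def)
  have eq: "indicator {0<..} x *\<^sub>R (g x * h x) = (g x / (1 + x)) * (indicator {0<..} x * ((1 + x) * h x))" for x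
    by (auto simp: indicator_def)
  have gm: "(\<lambda>x. g x / (1 + x)) \<in> borel_measurable lebesgue"
    using g by (intro measurable_completion) (simp add: borel_measurable_divide)
  show ?thesis
    unfolding set_integrable_def
  proof (rule Bochner_Integration.integrable_bound)
    show "integrable lebesgue (\<lambda>x. K * (indicator {0<..} x * ((1 + x) * h x)))"
      using int by simp
    show "(\<lambda>x. indicator {0<..} x *\<^sub>R (g x * h x)) \<in> borel_measurable lebesgue"
      unfolding eq using gm borel_measurable_integrable[OF int] by (rule borel_measurable_times)
    show "AE x in lebesgue. norm (indicator {0<..} x *\<^sub>R (g x * h x))
        \<le> norm (K * (indicator {0<..} x * ((1 + x) * h x)))"
    proof (intro AE_I2)
      fix x :: real
      show "norm (indicator {0<..} x *\<^sub>R (g x * h x)) \<le> norm (K * (indicator {0<..} x * ((1 + x) * h x)))"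
      proof (cases "x > 0")
        case True
        have "\<bar>g x\<bar> \<le> \<bar>K\<bar> * (1 + x)"
          using bd[OF True] mult_right_mono[of K "\<bar>K\<bar>" "1 + x"] True by linarith
        then have "\<bar>g x\<bar> * \<bar>h x\<bar> \<le> \<bar>K\<bar> * (1 + x) * \<bar>h x\<bar>"
          by (rule mult_right_mono) simp
        then show ?thesis using True by (simp add: abs_mult mult.assoc)
      qed simp
    qed
  qed
qed

text \<open>The quotient \<open>g / (1 + x)\<close> is bounded on the half-line, hence an admissible
  test function for weak continuity.\<close>

lemma weakly_continuous_moment:
  assumes f: "weakly_continuous_L1 f" and g: "g \<in> borel_measurable borel"
    and bd: "\<And>x. x > 0 \<Longrightarrow> \<bar>g x\<bar> \<le> K * (1 + x)"
  shows "continuous_on {0..} (\<lambda>t. LINT x:{0<..}|lebesgue. g x * f t x)"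
proof -
  have "(\<lambda>x. g x / (1 + x)) \<in> Linf_pos"
    unfolding Linf_pos_def
  proof (safe intro!: exI[of _ K] AE_I2)
    have "(\<lambda>x. g x / (1 + x)) \<in> borel_measurable borel"
      using g by (simp add: borel_measurable_divide)
    then have "(\<lambda>x. indicator {0<..} x *\<^sub>R (g x / (1 + x))) \<in> borel_measurable lborel"
      unfolding measurable_lborel1 by (intro borel_measurable_scaleR borel_measurable_indicator) auto
    then show "set_borel_measurable lebesgue {0<..} (\<lambda>x. g x / (1 + x))"
      unfolding set_borel_measurable_def by (rule measurable_completion)
    show "\<bar>g x / (1 + x)\<bar> \<le> K" if "0 < x" for x
      using bd[OF that] that by (simp add: field_simps)
  qed
  then have "continuous_on {0..} (\<lambda>t. LINT x:{0<..}|lebesgue. f t x * (g x / (1 + x)) * (1 + x))"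
    by (rule bspec[OF conjunct2[OF f[unfolded weakly_continuous_L1_def]]])
  moreover have "(LINT x:{0<..}|lebesgue. f t x * (g x / (1 + x)) * (1 + x)) = (LINT x:{0<..}|lebesgue. g x * f t x)" for t
    unfolding set_lebesgue_integral_def
    by (rule Bochner_Integration.integral_cong) (auto simp: indicator_def)
  ultimately show ?thesis by simp
qed

section \<open>Classical derivatives as distributional derivatives\<close>

lemma set_integral_eq_integral_Icc:
  fixes g :: "real \<Rightarrow> real"
  assumes S: "{c..d} \<subseteq> S" and out: "\<And>x. x \<in> S \<Longrightarrow> x \<notin> {c..d} \<Longrightarrow> g x = 0"
    and g: "continuous_on {c..d} g"
  shows "(LINT x:S|lebesgue. g x) = integral {c..d} g"
proof -
  have "(LINT x:S|lebesgue. g x) = (LINT x:{c..d}|lebesgue. g x)"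
    unfolding set_lebesgue_integral_def
    using S out by (intro Bochner_Integration.integral_cong) (auto simp: indicator_def)
  also have "\<dots> = integral {c..d} g"
    using absolutely_integrable_continuous_real[OF g] by (rule set_lebesgue_integral_eq_integral)
  finally show ?thesis .
qed

text \<open>Integration by parts on a compact interval with the support of \<open>\<psi>\<close> in
  its interior. This makes the explicit test functions used below admissible in the weak
  formulation.\<close>

lemma weak_derivative_C1:
  assumes der: "\<And>x. x > 0 \<Longrightarrow> (\<phi> has_real_derivative d\<phi> x) (at x)"
    and cont: "continuous_on {0<..} d\<phi>"
  shows "weak_derivative \<phi> d\<phi>"
  unfolding weak_derivative_def
proof (intro allI impI)
  fix \<psi> :: "real \<Rightarrow> real"
  define S where "S = closure {x. \<psi> x \<noteq> 0}"
  assume \<psi>: "smooth_compact_support \<psi>"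
  then have S: "compact S" "S \<subseteq> {0<..}"
    and diff: "\<And>n x. ((deriv ^^ n) \<psi>) differentiable (at x)"
    by (auto simp: smooth_compact_support_def S_def)
  have d0: "(\<psi> has_real_derivative deriv \<psi> x) (at x)" for x
    using diff[of 0 x] by (simp add: DERIV_deriv_iff_real_differentiable)
  have "deriv \<psi> differentiable (at x)" for x
    using diff[of 1 x] by simp
  then have cd: "continuous_on T (deriv \<psi>)" for T
    by (meson continuous_at_imp_continuous_on differentiable_imp_continuous_within)
  have c0: "continuous_on T \<psi>" for T
    by (meson DERIV_isCont continuous_at_imp_continuous_on d0)
  have out: "\<psi> x = 0" if "x \<notin> S" for x
    using that closure_subset[of "{x. \<psi> x \<noteq> 0}"] by (auto simp: S_def)
  have dout: "deriv \<psi> x = 0" if "x \<notin> S" for x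
  proof -
    have "open (- S)" by (simp add: S_def open_Compl)
    then have "(\<psi> has_real_derivative 0) (at x)"
      using has_field_derivative_transform_within_open[of "\<lambda>_. 0" 0 x "- S" \<psi>] that out by auto
    then show ?thesis by (rule DERIV_imp_deriv)
  qed
  \<comment> \<open>The support has to lie strictly inside, so that the boundary terms vanish;
    \<open>p/2\<close> keeps the interval away from 0. An empty support gets a degenerate interval
    at 1.\<close>
  obtain c d where cd': "0 < c" "c \<le> d" "S \<subseteq> {c<..<d}"
  proof (cases "S = {}")
    case False
    obtain p q where p: "p \<in> S" "\<And>x. x \<in> S \<Longrightarrow> p \<le> x" and q: "q \<in> S" "\<And>x. x \<in> S \<Longrightarrow> x \<le> q"
      using compact_attains_inf[OF S(1) False] compact_attains_sup[OF S(1) False] by metis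
    have "p > 0" using p(1) S(2) by auto
    with p q that[of "p/2" "q + 1"] show ?thesis by fastforce
  qed (use that[of 1 1] in auto)
  have pos: "{c..d} \<subseteq> {0<..}" using cd' by auto
  have c\<phi>: "continuous_on {c..d} \<phi>"
    using pos by (intro continuous_at_imp_continuous_on) (auto intro: DERIV_isCont der)
  have cd\<phi>: "continuous_on {c..d} d\<phi>" using cont pos by (rule continuous_on_subset)
  have "c \<notin> S" "d \<notin> S" using cd'(3) by auto
  then have ends: "\<psi> c = 0" "\<psi> d = 0" by (simp_all add: out)
  have z: "\<psi> x = 0 \<and> deriv \<psi> x = 0" if "x \<notin> {c..d}" for x
  proof -
    have "x \<notin> S" using that cd'(3) by auto
    then show ?thesis by (simp add: out dout)
  qed
  have ftc: "((\<lambda>x. \<phi> x * deriv \<psi> x + d\<phi> x * \<psi> x) has_integral (\<phi> d * \<psi> d - \<phi> c * \<psi> c)) {c..d}"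
  proof (rule fundamental_theorem_of_calculus)
    fix x assume "x \<in> {c..d}"
    then have "x > 0" using cd' by auto
    then have "((\<lambda>x. \<phi> x * \<psi> x) has_real_derivative \<phi> x * deriv \<psi> x + d\<phi> x * \<psi> x) (at x)"
      using DERIV_mult[OF der d0, of x] by (simp add: algebra_simps)
    then show "((\<lambda>x. \<phi> x * \<psi> x) has_vector_derivative \<phi> x * deriv \<psi> x + d\<phi> x * \<psi> x) (at x within {c..d})"
      by (simp add: has_real_derivative_iff_has_vector_derivative has_vector_derivative_at_within)
  qed (use cd' in auto)
  have k1: "continuous_on {c..d} (\<lambda>x. \<phi> x * deriv \<psi> x)" and k2: "continuous_on {c..d} (\<lambda>x. d\<phi> x * \<psi> x)"
    by (intro continuous_intros c\<phi> cd c0 cd\<phi>)+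
  have "integral {c..d} (\<lambda>x. \<phi> x * deriv \<psi> x) + integral {c..d} (\<lambda>x. d\<phi> x * \<psi> x) = 0"
    using integral_unique[OF ftc] ends
      Henstock_Kurzweil_Integration.integral_add[OF integrable_continuous_real[OF k1] integrable_continuous_real[OF k2]] by simp
  then show "(LINT x:{0<..}|lebesgue. \<phi> x * deriv \<psi> x) = - (LINT x:{0<..}|lebesgue. d\<phi> x * \<psi> x)"
    using set_integral_eq_integral_Icc[OF pos _ k1] set_integral_eq_integral_Icc[OF pos _ k2] z by simp
qed

section \<open>The class of admissible weights, and a barrier principle\<close>

text \<open>Under this condition \<open>g / (1 + x)\<close> is bounded on the half-line, so moments
  with weight \<open>g\<close> are finite on \<open>weighted_L1\<close> and continuous in time along
  a weakly continuous \<open>f\<close>.\<close>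

definition linear_growth :: "(real \<Rightarrow> real) \<Rightarrow> bool" where
  "linear_growth g \<longleftrightarrow> g \<in> borel_measurable borel \<and> (\<exists>K. \<forall>x>0. \<bar>g x\<bar> \<le> K * (1 + x))"

lemma linear_growthI:
  assumes "g \<in> borel_measurable borel" and "\<And>x. x > 0 \<Longrightarrow> \<bar>g x\<bar> \<le> K * (1 + x)"
  shows "linear_growth g"
  using assms by (auto simp: linear_growth_def)

lemma linear_growth_add:
  assumes "linear_growth g" "linear_growth h"
  shows "linear_growth (\<lambda>x. g x + h x)"
proof -
  obtain K L where "\<And>x. x > 0 \<Longrightarrow> \<bar>g x\<bar> \<le> K * (1 + x)" "\<And>x. x > 0 \<Longrightarrow> \<bar>h x\<bar> \<le> L * (1 + x)"
    using assms by (auto simp: linear_growth_def)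
  then have "\<bar>g x + h x\<bar> \<le> (K + L) * (1 + x)" if "x > 0" for x
    using that abs_triangle_ineq[of "g x" "h x"] by (fastforce simp: algebra_simps)
  with assms show ?thesis by (intro linear_growthI) (auto simp: linear_growth_def)
qed

lemma linear_growth_cmult:
  assumes "linear_growth g"
  shows "linear_growth (\<lambda>x. c * g x)"
proof -
  obtain K where K: "\<And>x. x > 0 \<Longrightarrow> \<bar>g x\<bar> \<le> K * (1 + x)"
    using assms by (auto simp: linear_growth_def)
  have "\<bar>c * g x\<bar> \<le> (\<bar>c\<bar> * K) * (1 + x)" if "x > 0" for x
    using mult_left_mono[OF K[OF that], of "\<bar>c\<bar>"] by (simp add: abs_mult mult.assoc)
  with assms show ?thesis by (intro linear_growthI) (auto simp: linear_growth_def)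
qed

lemma powr_le_one_plus:
  fixes x \<beta> :: real
  assumes "x > 0" "0 \<le> \<beta>" "\<beta> \<le> 1"
  shows "x powr \<beta> \<le> 1 + x"
proof (cases "x \<le> 1")
  case True
  then have "x powr \<beta> \<le> 1" using assms by (simp add: powr_le1)
  then show ?thesis using assms by simp
next
  case False
  then have "x powr \<beta> \<le> x powr 1" using assms by (intro powr_mono) auto
  then show ?thesis using assms by simp
qed

text \<open>A maximum of \<open>w\<close> over \<open>{t0..t}\<close> above \<open>K\<close> would
  be attained at some \<open>s > t0\<close>; the derivative is negative there, so \<open>w\<close>
  is even larger just before \<open>s\<close>.\<close>

lemma le_of_deriv_neg_above:
  fixes w :: "real \<Rightarrow> real"
  assumes der: "\<And>t. t \<ge> t0 \<Longrightarrow> (w has_real_derivative w' t) (at t)"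
    and start: "w t0 \<le> K" and neg: "\<And>t. t \<ge> t0 \<Longrightarrow> w t > K \<Longrightarrow> w' t < 0"
    and t: "t \<ge> t0"
  shows "w t \<le> K"
proof (rule ccontr)
  assume "\<not> w t \<le> K"
  have "continuous_on {t0..t} w"
    by (intro continuous_at_imp_continuous_on ballI DERIV_isCont[OF der]) simp
  then obtain s where s: "s \<in> {t0..t}" "\<And>r. r \<in> {t0..t} \<Longrightarrow> w r \<le> w s"
    using continuous_attains_sup[of "{t0..t}" w] t by auto
  have "w s > K" using s(2)[of t] \<open>\<not> w t \<le> K\<close> t by auto
  then have "s \<noteq> t0" using start by auto
  then have "s > t0" using s(1) by auto
  obtain d where d: "d > 0" "\<And>h. 0 < h \<Longrightarrow> h < d \<Longrightarrow> w s < w (s - h)"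
    using DERIV_neg_dec_left[OF der[of s]] neg[of s] \<open>w s > K\<close> s(1) by auto
  define h where "h = min (d / 2) (s - t0)"
  have "0 < h" "h < d" "s - h \<in> {t0..t}" using d(1) \<open>s > t0\<close> s(1) by (auto simp: h_def)
  then show False using d(2)[of h] s(2)[of "s - h"] by simp
qed

section \<open>Moments of a global solution\<close>

locale lifshitz_slyozov =
  fixes a b \<beta> \<rho> :: real and i0 :: nat
    and f_in :: "real \<Rightarrow> real" and f :: "real \<Rightarrow> real \<Rightarrow> real"
  assumes a: "a > 0" and b: "b > 0" and \<beta>0: "0 < \<beta>" and \<beta>1: "\<beta> \<le> 1" and i0: "i0 \<ge> 1" and \<rho>: "\<rho> > 0"
    and f_in: "f_in \<in> weighted_L1" and f_in_nonneg: "nonneg_ae f_in"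
    and f_in_2: "set_integrable lebesgue {0<..} (\<lambda>x. x\<^sup>2 * f_in x)"
    and sol: "global_solution (\<lambda>x. a) (\<lambda>x. b * x powr \<beta>) (\<lambda>z. z ^ i0) f_in \<rho> f"
begin

abbreviation u :: "real \<Rightarrow> real" where
  "u \<equiv> monomer \<rho> f"

definition moment :: "(real \<Rightarrow> real) \<Rightarrow> real \<Rightarrow> real" where
  "moment g t = (LINT x:{0<..}|lebesgue. g x * f t x)"

lemma weakly_continuous: "weakly_continuous_L1 f"
  using sol by (simp add: global_solution_def)

lemma f_nonneg: "t \<ge> 0 \<Longrightarrow> nonneg_ae (f t)"
  using sol by (simp add: global_solution_def)

lemma u_pos: "t \<ge> 0 \<Longrightarrow> u t > 0"
  using sol by (simp add: global_solution_def)

lemma u_nonneg: "t \<ge> 0 \<Longrightarrow> 0 \<le> u t"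
  by (rule less_imp_le[OF u_pos])

lemma linear_growth_one: "linear_growth (\<lambda>x. 1)"
  by (rule linear_growthI[of _ 1]) auto

lemma linear_growth_id: "linear_growth (\<lambda>x. x)"
  by (rule linear_growthI[of _ 1]) auto

lemma linear_growth_powr: "linear_growth (\<lambda>x. x powr \<beta>)"
  by (rule linear_growthI[of _ 1]) (use powr_le_one_plus[of _ \<beta>] \<beta>0 \<beta>1 in auto)

lemma linear_growth_powr_mult:
  assumes "h \<in> borel_measurable borel" "\<And>x. x > 0 \<Longrightarrow> \<bar>h x\<bar> \<le> K"
  shows "linear_growth (\<lambda>x. x powr \<beta> * h x)"
proof (rule linear_growthI[of _ K])
  fix x :: real assume x: "x > 0"
  have "\<bar>h x\<bar> * (x powr \<beta>) \<le> K * (1 + x)"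
    using x assms(2)[OF x] powr_le_one_plus[OF x, of \<beta>] \<beta>0 \<beta>1 by (intro mult_mono) auto
  then show "\<bar>x powr \<beta> * h x\<bar> \<le> K * (1 + x)" by (simp add: abs_mult mult.commute)
qed (use assms(1) in measurable)

lemma moment_integrable:
  assumes "linear_growth g" "t \<ge> 0"
  shows "set_integrable lebesgue {0<..} (\<lambda>x. g x * f t x)"
  using assms weakly_continuous weighted_L1_integrable[of "f t" g]
  by (auto simp: linear_growth_def weakly_continuous_L1_def)

lemma moment_continuous:
  assumes "linear_growth g"
  shows "continuous_on {0..} (moment g)"
  using assms weakly_continuous_moment[OF weakly_continuous, of g]
  by (auto simp: linear_growth_def moment_def[abs_def])

lemma moment_add:
  assumes "linear_growth g" "linear_growth h" "t \<ge> 0"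
  shows "moment (\<lambda>x. g x + h x) t = moment g t + moment h t"
  using set_integral_add(2)[OF moment_integrable[OF assms(1,3)] moment_integrable[OF assms(2,3)]]
  by (simp add: moment_def distrib_right)

lemma moment_cmult: "moment (\<lambda>x. c * g x) t = c * moment g t"
  by (simp add: moment_def mult.assoc)

lemma moment_mono:
  assumes "linear_growth g" "linear_growth h" "t \<ge> 0" "\<And>x. x > 0 \<Longrightarrow> g x \<le> h x"
  shows "moment g t \<le> moment h t"
  unfolding moment_def
proof (rule set_integral_mono_AE[OF moment_integrable[OF assms(1,3)] moment_integrable[OF assms(2,3)]])
  show "AE x\<in>{0<..} in lebesgue. g x * f t x \<le> h x * f t x"
    using f_nonneg[OF assms(3)] unfolding nonneg_ae_def
    by eventually_elim (auto intro: mult_right_mono assms(4))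
qed

lemma moment_nonneg:
  assumes "linear_growth g" "t \<ge> 0" "\<And>x. x > 0 \<Longrightarrow> 0 \<le> g x"
  shows "0 \<le> moment g t"
  using moment_mono[OF linear_growth_cmult[OF assms(1), of 0] assms(1,2)] assms(3)
    moment_cmult[of 0 g t] by simp

lemma M0_moment: "M0 f = moment (\<lambda>x. 1)"
  by (simp add: fun_eq_iff M0_def moment_def)

lemma u_moment: "u t = \<rho> - moment (\<lambda>x. x) t"
  by (simp add: monomer_def moment_def)

lemma M0_nonneg: "t \<ge> 0 \<Longrightarrow> 0 \<le> M0 f t"
  unfolding M0_moment by (rule moment_nonneg[OF linear_growth_one]) auto

lemma u_le: "t \<ge> 0 \<Longrightarrow> u t \<le> \<rho>"
  using moment_nonneg[OF linear_growth_id, of t] by (simp add: u_moment)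

lemma M0_continuous: "continuous_on {0..} (M0 f)"
  unfolding M0_moment by (rule moment_continuous[OF linear_growth_one])

lemma u_continuous: "continuous_on {0..} u"
  unfolding u_moment[abs_def] by (intro continuous_intros moment_continuous linear_growth_id)

abbreviation M\<beta> :: "real \<Rightarrow> real" where
  "M\<beta> \<equiv> moment (\<lambda>x. x powr \<beta>)"

lemma M\<beta>_continuous: "continuous_on {0..} M\<beta>"
  by (rule moment_continuous[OF linear_growth_powr])

section \<open>Moment identities and the differential equations for \<open>M0 f\<close> and
  \<open>u\<close>\<close>

text \<open>The weak formulation for a continuously differentiable test function. The time
  integrands are continuous, so their Lebesgue integrals may be replaced by gauge integrals, to
  which the fundamental theorem of calculus applies later.\<close>

lemma moment_identity:
  assumes t: "t \<ge> 0"
    and der: "\<And>x. x > 0 \<Longrightarrow> (\<phi> has_real_derivative d\<phi> x) (at x)"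
    and cont: "continuous_on {0<..} d\<phi>" "continuous_on {0..} \<phi>"
    and meas: "d\<phi> \<in> borel_measurable borel" and bd: "\<And>x. x > 0 \<Longrightarrow> \<bar>d\<phi> x\<bar> \<le> K"
  shows "moment \<phi> t = (LINT x:{0<..}|lebesgue. \<phi> x * f_in x)
    + integral {0..t} (\<lambda>s. a * u s * moment d\<phi> s - b * moment (\<lambda>x. x powr \<beta> * d\<phi> x) s)
    + \<phi> 0 * integral {0..t} (\<lambda>s. u s ^ i0)"
proof -
  have d\<phi>: "d\<phi> \<in> Linf_pos"
    unfolding Linf_pos_def
  proof (safe intro!: exI[of _ K] AE_I2)
    have "(\<lambda>x. indicator {0<..} x *\<^sub>R d\<phi> x) \<in> borel_measurable lborel"
      using meas by (simp add: borel_measurable_scaleR borel_measurable_indicator)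
    then show "set_borel_measurable lebesgue {0<..} d\<phi>"
      unfolding set_borel_measurable_def by (rule measurable_completion)
  qed (rule bd)
  have g1: "linear_growth d\<phi>"
  proof (rule linear_growthI[OF meas, of K])
    fix x :: real assume x: "x > 0"
    have "K * 1 \<le> K * (1 + x)" using bd[OF x] x by (intro mult_left_mono) linarith+
    then show "\<bar>d\<phi> x\<bar> \<le> K * (1 + x)" using bd[OF x] by linarith
  qed
  have g2: "linear_growth (\<lambda>x. x powr \<beta> * d\<phi> x)"
    using meas bd by (rule linear_growth_powr_mult)
  have sub: "{0..t} \<subseteq> {0..}" by auto
  have c1: "continuous_on {0..t} (\<lambda>s. a * u s * moment d\<phi> s - b * moment (\<lambda>x. x powr \<beta> * d\<phi> x) s)"
    by (intro continuous_intros continuous_on_subset[OF _ sub] u_continuous moment_continuous g1 g2)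
  have c2: "continuous_on {0..t} (\<lambda>s. \<phi> 0 * u s ^ i0)"
    by (intro continuous_intros continuous_on_subset[OF _ sub] u_continuous)
  have inner: "(LINT x:{0<..}|lebesgue. (a * u s - b * x powr \<beta>) * d\<phi> x * f s x)
      = a * u s * moment d\<phi> s - b * moment (\<lambda>x. x powr \<beta> * d\<phi> x) s" if "s \<ge> 0" for s
  proof -
    have "(\<lambda>x. (a * u s - b * x powr \<beta>) * d\<phi> x * f s x)
        = (\<lambda>x. (a * u s * d\<phi> x + (- b) * (x powr \<beta> * d\<phi> x)) * f s x)"
      by (simp add: fun_eq_iff algebra_simps)
    then show ?thesis
      using moment_add[OF linear_growth_cmult[OF g1, of "a * u s"] linear_growth_cmult[OF g2, of "- b"] that]
        moment_cmult[of "a * u s" d\<phi> s] moment_cmult[of "- b" "\<lambda>x. x powr \<beta> * d\<phi> x" s]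
      by (simp add: moment_def)
  qed
  have "moment \<phi> t = (LINT x:{0<..}|lebesgue. \<phi> x * f_in x)
          + (LINT s:{0..t}|lebesgue. LINT x:{0<..}|lebesgue.
               (a * u s - b * x powr \<beta>) * d\<phi> x * f s x)
          + (LINT s:{0..t}|lebesgue. \<phi> 0 * u s ^ i0)"
    using sol t d\<phi> cont(2) weak_derivative_C1[OF der cont(1)]
    unfolding global_solution_def moment_def by blast
  also have "(LINT s:{0..t}|lebesgue. LINT x:{0<..}|lebesgue. (a * u s - b * x powr \<beta>) * d\<phi> x * f s x)
      = (LINT s:{0..t}|lebesgue. a * u s * moment d\<phi> s - b * moment (\<lambda>x. x powr \<beta> * d\<phi> x) s)"
    using inner by (intro set_lebesgue_integral_cong) auto
  also have "\<dots> = integral {0..t} (\<lambda>s. a * u s * moment d\<phi> s - b * moment (\<lambda>x. x powr \<beta> * d\<phi> x) s)"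
    by (rule set_integral_eq_integral_Icc[OF order_refl _ c1]) auto
  also have "(LINT s:{0..t}|lebesgue. \<phi> 0 * u s ^ i0) = \<phi> 0 * integral {0..t} (\<lambda>s. u s ^ i0)"
    by (subst set_integral_eq_integral_Icc[OF order_refl _ c2]) auto
  finally show ?thesis .
qed

text \<open>For the test function 1 the transport term vanishes and only nucleation
  contributes.\<close>

lemma M0_integral:
  assumes "t \<ge> 0"
  shows "M0 f t = (LINT x:{0<..}|lebesgue. f_in x) + integral {0..t} (\<lambda>s. u s ^ i0)"
proof -
  have "moment (\<lambda>x. 0) s = 0" for s by (simp add: moment_def)
  then show ?thesis
    using moment_identity[of t "\<lambda>x. 1" "\<lambda>x. 0" 0] assms by (simp add: M0_moment)
qed

text \<open>The test function \<open>x\<close> vanishes at 0: newly nucleated clusters carry no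
  mass.\<close>

lemma u_integral:
  assumes "t \<ge> 0"
  shows "u t = \<rho> - (LINT x:{0<..}|lebesgue. x * f_in x) - integral {0..t} (\<lambda>s. a * u s * M0 f s - b * M\<beta> s)"
  using moment_identity[of t "\<lambda>x. x" "\<lambda>x. 1" 1] assms by (simp add: M0_moment u_moment)

lemma M0_deriv:
  assumes "t > 0"
  shows "(M0 f has_real_derivative u t ^ i0) (at t)"
proof -
  \<comment> \<open>Extending the interval beyond \<open>t\<close> makes \<open>t\<close> an
    interior point, so the derivative within the interval is two-sided.\<close>
  have "continuous_on {0..t+1} (\<lambda>s. u s ^ i0)"
    by (intro continuous_intros continuous_on_subset[OF u_continuous]) auto
  then have "((\<lambda>t. integral {0..t} (\<lambda>s. u s ^ i0)) has_real_derivative u t ^ i0) (at t within {0..t+1})"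
    using assms by (intro integral_has_real_derivative) auto
  then have "((\<lambda>t. integral {0..t} (\<lambda>s. u s ^ i0)) has_real_derivative u t ^ i0) (at t)"
    using assms by (simp add: at_within_Icc_at)
  then have "((\<lambda>t. (LINT x:{0<..}|lebesgue. f_in x) + integral {0..t} (\<lambda>s. u s ^ i0)) has_real_derivative u t ^ i0) (at t)"
    by (auto intro!: derivative_eq_intros)
  then show ?thesis
    by (rule has_field_derivative_transform_within_open[of _ _ _ "{0<..}"]) (use assms M0_integral in auto)
qed

lemma u_deriv:
  assumes "t > 0"
  shows "(u has_real_derivative b * M\<beta> t - a * u t * M0 f t) (at t)"
proof -
  let ?g = "\<lambda>s. a * u s * M0 f s - b * M\<beta> s"
  have "continuous_on {0..t+1} ?g"
    by (intro continuous_intros continuous_on_subset[OF u_continuous]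
        continuous_on_subset[OF M0_continuous] continuous_on_subset[OF M\<beta>_continuous]) auto
  then have "((\<lambda>t. integral {0..t} ?g) has_real_derivative ?g t) (at t within {0..t+1})"
    using assms by (intro integral_has_real_derivative[of 0 "t+1" ?g t]) auto
  then have "((\<lambda>t. integral {0..t} ?g) has_real_derivative ?g t) (at t)"
    using assms by (simp add: at_within_Icc_at)
  then have "((\<lambda>t. \<rho> - (LINT x:{0<..}|lebesgue. x * f_in x) - integral {0..t} ?g) has_real_derivative - ?g t) (at t)"
    by (auto intro!: derivative_eq_intros)
  then have "((\<lambda>t. \<rho> - (LINT x:{0<..}|lebesgue. x * f_in x) - integral {0..t} ?g) has_real_derivative b * M\<beta> t - a * u t * M0 f t) (at t)"
    by simp
  then show ?thesis
    by (rule has_field_derivative_transform_within_open[of _ _ _ "{0<..}"]) (use assms u_integral in auto)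
qed

lemma M0_mono:
  assumes "0 \<le> s" "s \<le> t"
  shows "M0 f s \<le> M0 f t"
proof -
  have "integral {0..s} (\<lambda>s. u s ^ i0) \<le> integral {0..t} (\<lambda>s. u s ^ i0)"
  proof (rule integral_subset_le)
    show "(\<lambda>s. u s ^ i0) integrable_on {0..s}" "(\<lambda>s. u s ^ i0) integrable_on {0..t}"
      by (intro integrable_continuous_real continuous_intros continuous_on_subset[OF u_continuous]; auto)+
    show "\<forall>x\<in>{0..t}. 0 \<le> u x ^ i0"
      by (simp add: u_nonneg)
  qed (use assms in auto)
  then show ?thesis using assms M0_integral by simp
qed

text \<open>Nucleation makes \<open>M0 f\<close> increase strictly at every \<open>t > 0\<close>, so
  positivity holds even if \<open>f_in\<close> vanishes. It permits negative powers of
  \<open>M0 f t\<close> below.\<close>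

lemma M0_pos:
  assumes "t > 0"
  shows "0 < M0 f t"
proof -
  obtain d where d: "d > 0" "\<And>h. 0 < h \<Longrightarrow> h < d \<Longrightarrow> M0 f (t - h) < M0 f t"
    using DERIV_pos_inc_left[OF M0_deriv[OF assms]] u_pos[of t] assms by auto
  define h where "h = min (d/2) t"
  have "0 < h" "h < d" "0 \<le> t - h" using d assms by (auto simp: h_def)
  then show ?thesis using d(2)[of h] M0_nonneg[of "t - h"] by linarith
qed

section \<open>Interpolation of the moment of order \<beta> between number and mass\<close>

text \<open>This is \<open>y powr \<beta> \<le> 1 + y\<close> rescaled by a length \<open>L\<close>
  that is left free, to be adapted to the number of clusters.\<close>

lemma powr_split:
  fixes x L :: real
  assumes "x > 0" "L > 0"
  shows "x powr \<beta> \<le> L powr \<beta> + L powr (\<beta> - 1) * x"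
proof -
  have "(x / L) powr \<beta> \<le> 1 + x / L" using assms \<beta>0 \<beta>1 by (intro powr_le_one_plus) auto
  then have "L powr \<beta> * (x / L) powr \<beta> \<le> L powr \<beta> * (1 + x / L)" by (intro mult_left_mono) auto
  then show ?thesis using assms by (simp add: powr_divide powr_diff algebra_simps)
qed

lemma M\<beta>_le:
  assumes "t > 0"
  shows "M\<beta> t \<le> (1 + \<rho>) * M0 f t powr (1 - \<beta>)"
proof -
  let ?N = "M0 f t"
  \<comment> \<open>At this length both \<open>L powr \<beta> * ?N\<close> and
    \<open>L powr (\<beta> - 1)\<close> equal \<open>?N powr (1 - \<beta>)\<close>.\<close>
  define L where "L = inverse ?N"
  have N: "?N > 0" using M0_pos[OF assms] .
  then have L: "L > 0" by (simp add: L_def)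
  have "M\<beta> t \<le> moment (\<lambda>x. L powr \<beta> * 1 + L powr (\<beta> - 1) * x) t"
    using assms powr_split[OF _ L]
    by (intro moment_mono linear_growth_powr linear_growth_add linear_growth_cmult linear_growth_one linear_growth_id) auto
  also have "\<dots> = L powr \<beta> * ?N + L powr (\<beta> - 1) * (\<rho> - u t)"
    using assms
    by (subst moment_add) (auto intro: linear_growth_cmult linear_growth_one linear_growth_id
        simp: moment_cmult M0_moment u_moment simp del: mult_1_right)
  also have "L powr \<beta> * ?N = ?N powr (1 - \<beta>)"
    using N by (simp add: L_def powr_divide powr_diff inverse_eq_divide)
  also have "L powr (\<beta> - 1) = ?N powr (1 - \<beta>)"
    using N by (simp add: L_def inverse_powr powr_minus[symmetric])
  also have "?N powr (1 - \<beta>) + ?N powr (1 - \<beta>) * (\<rho> - u t) \<le> (1 + \<rho>) * ?N powr (1 - \<beta>)"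
    using u_pos[of t] assms by (simp add: algebra_simps)
  finally show ?thesis .
qed

section \<open>Truncated control of the moment of order 1 + \<beta>\<close>

definition M2_in :: real where
  "M2_in = (LINT x:{0<..}|lebesgue. x\<^sup>2 * f_in x)"

text \<open>A rational substitute for the minimum of \<open>R\<close> and \<open>x\<close>: on the
  half-line it is bounded, so it can be the derivative of an admissible test function, and it tends
  to \<open>x\<close> as \<open>R\<close> grows.\<close>

definition cutoff :: "real \<Rightarrow> real \<Rightarrow> real" where
  "cutoff R x = R * x / (R + x)"

lemma cutoff_bounds:
  assumes "R > 0" "x > 0"
  shows "0 \<le> cutoff R x" "cutoff R x \<le> x" "cutoff R x \<le> R"
  using assms by (simp_all add: cutoff_def field_simps)

lemma cutoff_measurable: "cutoff R \<in> borel_measurable borel"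
  unfolding cutoff_def by measurable

lemma linear_growth_cutoff:
  assumes "R > 0"
  shows "linear_growth (cutoff R)"
proof (rule linear_growthI[OF cutoff_measurable, of _ 1])
  fix x :: real assume x: "x > 0"
  show "\<bar>cutoff R x\<bar> \<le> 1 * (1 + x)"
    using cutoff_bounds[OF assms x] by simp
qed

lemma linear_growth_powr_cutoff:
  assumes "R > 0"
  shows "linear_growth (\<lambda>x. x powr \<beta> * cutoff R x)"
  by (rule linear_growth_powr_mult[OF cutoff_measurable, of _ R])
    (use cutoff_bounds[OF assms] in \<open>simp add: abs_of_nonneg\<close>)

lemma moment_cutoff_le:
  assumes "R > 0" "t \<ge> 0"
  shows "0 \<le> moment (cutoff R) t" "moment (cutoff R) t \<le> \<rho> - u t" "moment (cutoff R) t \<le> \<rho>"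
proof -
  show "0 \<le> moment (cutoff R) t"
    using assms cutoff_bounds by (intro moment_nonneg linear_growth_cutoff) auto
  show "moment (cutoff R) t \<le> \<rho> - u t"
    using moment_mono[OF linear_growth_cutoff[OF assms(1)] linear_growth_id assms(2)] cutoff_bounds[OF assms(1)]
    by (simp add: u_moment)
  with u_pos[OF assms(2)] show "moment (cutoff R) t \<le> \<rho>" by linarith
qed

text \<open>
  The test function \<open>x\<^sup>2\<close> is not admissible; it is replaced by the primitive of \<open>cutoff R\<close>, which
  grows linearly and lies below \<open>x\<^sup>2\<close>.
\<close>

lemma integral_powr_cutoff_le:
  assumes T: "T \<ge> 0" and R: "R > 0"
  shows "b * integral {0..T} (moment (\<lambda>x. x powr \<beta> * cutoff R x)) \<le> M2_in + a * \<rho> * integral {0..T} u"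
proof -
  \<comment> \<open>Integrates \<open>R * x / (R + x) = R - R\<^sup>2 / (R + x)\<close>; the
    constant is chosen so that \<open>\<phi> 0 = 0\<close>, which removes the nucleation
    term.\<close>
  define \<phi> where "\<phi> = (\<lambda>x. R * x - R\<^sup>2 * ln (1 + x / R))"
  have \<phi>0: "0 \<le> \<phi> x" if "x > 0" for x
  proof -
    have "R\<^sup>2 * ln (1 + x / R) \<le> R\<^sup>2 * (x / R)"
      using that R by (intro mult_left_mono ln_add_one_self_le_self) auto
    then show ?thesis using R by (simp add: \<phi>_def power2_eq_square)
  qed
  have \<phi>1: "\<phi> x \<le> R * x" if "x > 0" for x
    using that R by (simp add: \<phi>_def ln_ge_zero)
  \<comment> \<open>For \<open>x \<le> R\<close> this is
    \<open>ln (1 + y) \<ge> y - y\<^sup>2\<close> at \<open>y = x / R\<close>; for larger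
    \<open>x\<close> the linear bound suffices.\<close>
  have \<phi>2: "\<phi> x \<le> x\<^sup>2" if "x > 0" for x
  proof (cases "x \<le> R")
    case True
    then have "R\<^sup>2 * (x / R - (x / R)\<^sup>2) \<le> R\<^sup>2 * ln (1 + x / R)"
      using that R by (intro mult_left_mono ln_one_plus_pos_lower_bound) auto
    moreover have "R\<^sup>2 * (x / R - (x / R)\<^sup>2) = R * x - x\<^sup>2"
      using R by (simp add: field_simps power2_eq_square)
    ultimately show ?thesis by (simp add: \<phi>_def)
  next
    case False
    then have "R * x \<le> x\<^sup>2" using that R by (simp add: power2_eq_square)
    with \<phi>1[OF that] show ?thesis by linarith
  qed
  have \<phi>m: "\<phi> \<in> borel_measurable borel" unfolding \<phi>_def by measurable
  have \<phi>b: "\<bar>\<phi> x\<bar> \<le> R * (1 + x)" if "x > 0" for x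
  proof -
    have "R * x \<le> R * (1 + x)" using R by (intro mult_left_mono) auto
    with \<phi>0[OF that] \<phi>1[OF that] show ?thesis by linarith
  qed
  have der: "(\<phi> has_real_derivative cutoff R x) (at x)" if "x > 0" for x
  proof -
    have "1 + x / R > 0" using that R by (simp add: add_pos_pos)
    then have "(\<phi> has_real_derivative R - R\<^sup>2 * (1 / R / (1 + x / R))) (at x)"
      unfolding \<phi>_def using R by (auto intro!: derivative_eq_intros)
    moreover have "R - R\<^sup>2 * (1 / R / (1 + x / R)) = cutoff R x"
      using that R by (simp add: cutoff_def field_simps power2_eq_square)
    ultimately show ?thesis by simp
  qed
  have c1: "continuous_on {0<..} (cutoff R)"
    unfolding cutoff_def using R by (intro continuous_intros) auto
  have c2: "continuous_on {0..} \<phi>"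
  proof -
    have "1 + x / R \<noteq> 0" if "x \<ge> 0" for x using that R by (simp add: add_pos_nonneg less_imp_neq[symmetric])
    then show ?thesis unfolding \<phi>_def using R by (intro continuous_intros) auto
  qed
  have cb: "\<bar>cutoff R x\<bar> \<le> R" if "x > 0" for x
    using cutoff_bounds[OF R that] by linarith
  have "moment \<phi> T = (LINT x:{0<..}|lebesgue. \<phi> x * f_in x)
    + integral {0..T} (\<lambda>s. a * u s * moment (cutoff R) s - b * moment (\<lambda>x. x powr \<beta> * cutoff R x) s)
    + \<phi> 0 * integral {0..T} (\<lambda>s. u s ^ i0)"
    by (rule moment_identity[OF T der c1 c2 cutoff_measurable cb])
  moreover have "\<phi> 0 = 0" by (simp add: \<phi>_def)
  moreover have "0 \<le> moment \<phi> T"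
    using \<phi>0 by (intro moment_nonneg linear_growthI[OF \<phi>m \<phi>b] T) auto
  moreover have "(LINT x:{0<..}|lebesgue. \<phi> x * f_in x) \<le> M2_in"
    unfolding M2_in_def
  proof (rule set_integral_mono_AE[OF weighted_L1_integrable[OF f_in \<phi>m \<phi>b] f_in_2])
    show "AE x\<in>{0<..} in lebesgue. \<phi> x * f_in x \<le> x\<^sup>2 * f_in x"
      using f_in_nonneg unfolding nonneg_ae_def
      by eventually_elim (auto intro: mult_right_mono \<phi>2)
  qed
  \<comment> \<open>The truncated mass is at most \<rho>, which makes the final estimate uniform in
    \<open>R\<close>.\<close>
  moreover have "integral {0..T} (\<lambda>s. a * u s * moment (cutoff R) s - b * moment (\<lambda>x. x powr \<beta> * cutoff R x) s)
     \<le> integral {0..T} (\<lambda>s. a * \<rho> * u s - b * moment (\<lambda>x. x powr \<beta> * cutoff R x) s)"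
  proof (rule integral_le)
    show "a * u s * moment (cutoff R) s - b * moment (\<lambda>x. x powr \<beta> * cutoff R x) s
       \<le> a * \<rho> * u s - b * moment (\<lambda>x. x powr \<beta> * cutoff R x) s" if "s \<in> {0..T}" for s
      using mult_left_mono[OF moment_cutoff_le(3)[OF R], of s "a * u s"] u_pos[of s] a that
      by (simp add: mult_ac)
  qed (intro integrable_continuous_real continuous_intros continuous_on_subset[OF u_continuous]
        continuous_on_subset[OF moment_continuous[OF linear_growth_cutoff[OF R]]]
        continuous_on_subset[OF moment_continuous[OF linear_growth_powr_cutoff[OF R]]]; auto)+
  moreover have "integral {0..T} (\<lambda>s. a * \<rho> * u s - b * moment (\<lambda>x. x powr \<beta> * cutoff R x) s)
     = a * \<rho> * integral {0..T} u - b * integral {0..T} (moment (\<lambda>x. x powr \<beta> * cutoff R x))"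
    by (subst Henstock_Kurzweil_Integration.integral_diff)
      (auto intro!: integrable_continuous_real continuous_intros continuous_on_subset[OF u_continuous]
        continuous_on_subset[OF moment_continuous[OF linear_growth_powr_cutoff[OF R]]])
  ultimately show ?thesis by simp
qed

text \<open>Dominated convergence with the absolute value of \<open>x * f t x\<close> as majorant.
  The index \<open>Suc n\<close> keeps the truncation level positive.\<close>

lemma moment_cutoff_tendsto:
  assumes t: "t \<ge> 0"
  shows "(\<lambda>n. moment (cutoff (real (Suc n))) t) \<longlonglongrightarrow> \<rho> - u t"
proof -
  have "(\<lambda>n. LINT x|lebesgue. indicator {0<..} x *\<^sub>R (cutoff (real (Suc n)) x * f t x))
      \<longlonglongrightarrow> (LINT x|lebesgue. indicator {0<..} x *\<^sub>R (x * f t x))"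
  proof (rule integral_dominated_convergence)
    show "integrable lebesgue (\<lambda>x. \<bar>indicator {0<..} x *\<^sub>R (x * f t x)\<bar>)"
      using moment_integrable[OF linear_growth_id t] unfolding set_integrable_def by (rule integrable_abs)
    show "(\<lambda>x. indicator {0<..} x *\<^sub>R (x * f t x)) \<in> borel_measurable lebesgue"
      using moment_integrable[OF linear_growth_id t] unfolding set_integrable_def
      by (rule borel_measurable_integrable)
    show "(\<lambda>x. indicator {0<..} x *\<^sub>R (cutoff (real (Suc n)) x * f t x)) \<in> borel_measurable lebesgue" for n
      using moment_integrable[OF linear_growth_cutoff[of "real (Suc n)"] t] unfolding set_integrable_def
      by (intro borel_measurable_integrable) simp
    show "AE x in lebesgue. (\<lambda>n. indicator {0<..} x *\<^sub>R (cutoff (real (Suc n)) x * f t x))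
        \<longlonglongrightarrow> indicator {0<..} x *\<^sub>R (x * f t x)"
    proof (intro AE_I2 tendsto_scaleR tendsto_const tendsto_mult)
      show "(\<lambda>n. cutoff (real (Suc n)) x) \<longlonglongrightarrow> x" for x
      proof -
        have "(\<lambda>n. x / (1 + x / real (Suc n))) \<longlonglongrightarrow> x / (1 + 0)"
          by (intro tendsto_intros lim_const_over_n[THEN LIMSEQ_Suc]) auto
        moreover have "x / (1 + x / real (Suc n)) = cutoff (real (Suc n)) x" for n
          by (simp add: cutoff_def divide_simps)
        ultimately show ?thesis by simp
      qed
    qed
    show "AE x in lebesgue. norm (indicator {0<..} x *\<^sub>R (cutoff (real (Suc n)) x * f t x))
        \<le> \<bar>indicator {0<..} x *\<^sub>R (x * f t x)\<bar>" for n
    proof (intro AE_I2)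
      fix x :: real
      show "norm (indicator {0<..} x *\<^sub>R (cutoff (real (Suc n)) x * f t x)) \<le> \<bar>indicator {0<..} x *\<^sub>R (x * f t x)\<bar>"
      proof (cases "x > 0")
        case True
        have "\<bar>cutoff (real (Suc n)) x\<bar> \<le> \<bar>x\<bar>"
          using cutoff_bounds[of "real (Suc n)" x] True by linarith
        then have "\<bar>cutoff (real (Suc n)) x\<bar> * \<bar>f t x\<bar> \<le> \<bar>x\<bar> * \<bar>f t x\<bar>" by (rule mult_right_mono) simp
        with True show ?thesis by (simp add: abs_mult)
      qed simp
    qed
  qed
  then show ?thesis
    by (simp add: u_moment moment_def set_lebesgue_integral_def)
qed

section \<open>Lower bound for the number of clusters\<close>

text \<open>With \<open>y = x / L\<close>, one has
  \<open>y \<le> y powr \<beta> + y powr \<beta> * y\<close>, the first term covering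
  \<open>y \<le> 1\<close> and the second \<open>y > 1\<close>. After scaling by \<open>L\<close>,
  the factor \<open>R / (R + x)\<close> is absorbed into \<open>cutoff R x\<close> in the second
  term and dropped in the first, being at most 1.\<close>

lemma cutoff_split:
  fixes x L R :: real
  assumes "x > 0" "L > 0" "R > 0"
  shows "cutoff R x \<le> L powr (1 - \<beta>) * x powr \<beta> + L powr (- \<beta>) * (x powr \<beta> * cutoff R x)"
proof -
  have *: "y \<le> y powr \<beta> + y powr \<beta> * y" if "y > 0" for y :: real
  proof (cases "y \<le> 1")
    case True
    then have "y powr 1 \<le> y powr \<beta>" using that \<beta>1 by (intro powr_mono') auto
    then show ?thesis using that by (simp add: add_increasing2)
  next
    case False
    then have "1 \<le> y powr \<beta>" using \<beta>0 by (simp add: ge_one_powr_ge_zero)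
    then have "1 * y \<le> y powr \<beta> * y" using that by (intro mult_right_mono) auto
    then show ?thesis using powr_ge_zero[of y \<beta>] by linarith
  qed
  have "L * (x / L) \<le> L * ((x / L) powr \<beta> + (x / L) powr \<beta> * (x / L))"
    using assms by (intro mult_left_mono *) auto
  also have "\<dots> = L powr (1 - \<beta>) * x powr \<beta> + L powr (- \<beta>) * x powr \<beta> * x"
    using assms by (simp add: powr_divide powr_diff powr_minus field_simps)
  finally have "x \<le> L powr (1 - \<beta>) * x powr \<beta> + L powr (- \<beta>) * x powr \<beta> * x"
    using assms by simp
  then have "x * (R / (R + x)) \<le> (L powr (1 - \<beta>) * x powr \<beta> + L powr (- \<beta>) * x powr \<beta> * x) * (R / (R + x))"
    using assms by (intro mult_right_mono) auto
  also have "\<dots> = (L powr (1 - \<beta>) * x powr \<beta>) * (R / (R + x)) + L powr (- \<beta>) * (x powr \<beta> * cutoff R x)"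
    by (simp add: cutoff_def distrib_right distrib_left add_divide_distrib mult_ac)
  also have "(L powr (1 - \<beta>) * x powr \<beta>) * (R / (R + x)) \<le> L powr (1 - \<beta>) * x powr \<beta>"
    using assms by (intro mult_right_le_one_le) auto
  finally show ?thesis by (simp add: cutoff_def mult.commute)
qed

lemma u_integrable: "u integrable_on {0..T}"
  by (intro integrable_continuous_real continuous_on_subset[OF u_continuous]) auto

text \<open>\<open>cutoff_split\<close> is integrated in size and time, and then the truncation
  level tends to infinity. Only truncated moments of order 1 + \<beta> enter, with a bound uniform
  in the level, so the full moment need not be known to be finite.\<close>

lemma averaged_mass_le:
  assumes T: "T \<ge> 0" and L: "L > 0"
  shows "\<rho> * T - integral {0..T} u
    \<le> L powr (1 - \<beta>) * integral {0..T} M\<beta> + L powr (- \<beta>) * ((M2_in + a * \<rho> * integral {0..T} u) / b)"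
    (is "_ \<le> ?rhs")
proof -
  define c where "c = (\<lambda>n x. cutoff (real (Suc n)) x)"
  have cint: "moment (c n) integrable_on {0..T}" for n
    unfolding c_def
    by (intro integrable_continuous_real continuous_on_subset[OF moment_continuous[OF linear_growth_cutoff]]) auto
  have le: "integral {0..T} (moment (c n)) \<le> ?rhs" for n
  proof -
    let ?m = "moment (\<lambda>x. x powr \<beta> * c n x)"
    have lg: "linear_growth (c n)" "linear_growth (\<lambda>x. x powr \<beta> * c n x)"
      unfolding c_def by (intro linear_growth_cutoff linear_growth_powr_cutoff; simp)+
    have i1: "M\<beta> integrable_on {0..T}" and i2: "?m integrable_on {0..T}"
      by (intro integrable_continuous_real continuous_on_subset[OF M\<beta>_continuous]
          continuous_on_subset[OF moment_continuous[OF lg(2)]]; auto)+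
    have "integral {0..T} (moment (c n)) \<le> integral {0..T} (\<lambda>s. L powr (1 - \<beta>) * M\<beta> s + L powr (- \<beta>) * ?m s)"
    proof (rule integral_le[OF cint])
      show "(\<lambda>s. L powr (1 - \<beta>) * M\<beta> s + L powr (- \<beta>) * ?m s) integrable_on {0..T}"
        using i1 i2 by (intro integrable_add integrable_on_mult_right) auto
      fix s assume "s \<in> {0..T}"
      then have s: "s \<ge> 0" by simp
      have "moment (c n) s \<le> moment (\<lambda>x. L powr (1 - \<beta>) * x powr \<beta> + L powr (- \<beta>) * (x powr \<beta> * c n x)) s"
        using cutoff_split[OF _ L, of _ "real (Suc n)"] s
        by (intro moment_mono linear_growth_add linear_growth_cmult linear_growth_powr lg) (auto simp: c_def)
      then show "moment (c n) s \<le> L powr (1 - \<beta>) * M\<beta> s + L powr (- \<beta>) * ?m s"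
        using s by (subst (asm) moment_add) (auto intro: linear_growth_cmult linear_growth_powr lg simp: moment_cmult)
    qed
    also have "\<dots> = L powr (1 - \<beta>) * integral {0..T} M\<beta> + L powr (- \<beta>) * integral {0..T} ?m"
      using i1 i2 by (subst Henstock_Kurzweil_Integration.integral_add) (auto intro!: integrable_on_mult_right)
    also have "\<dots> \<le> ?rhs"
      using integral_powr_cutoff_le[OF T, of "real (Suc n)"] b
      by (intro add_left_mono mult_left_mono) (simp_all add: c_def pos_le_divide_eq mult.commute)
    finally show ?thesis .
  qed
  have "(\<lambda>n. integral {0..T} (moment (c n))) \<longlonglongrightarrow> integral {0..T} (\<lambda>s. \<rho> - u s)"
  proof (rule dominated_convergence(2)[OF cint])
    show "(\<lambda>_. \<rho>) integrable_on {0..T}" by (rule integrable_const_ivl)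
    show "norm (moment (c n) s) \<le> \<rho>" if "s \<in> {0..T}" for n s
      using moment_cutoff_le[of "real (Suc n)" s] that by (simp add: c_def)
    show "(\<lambda>n. moment (c n) s) \<longlonglongrightarrow> \<rho> - u s" if "s \<in> {0..T}" for s
      using moment_cutoff_tendsto[of s] that by (simp add: c_def)
  qed
  then have "integral {0..T} (\<lambda>s. \<rho> - u s) \<le> ?rhs"
    by (rule LIMSEQ_le_const2) (use le in auto)
  moreover have "integral {0..T} (\<lambda>s. \<rho> - u s) = \<rho> * T - integral {0..T} u"
    using T by (subst Henstock_Kurzweil_Integration.integral_diff) (auto intro: u_integrable)
  ultimately show ?thesis by simp
qed

text \<open>The integrated equation for \<open>u\<close> expresses the left side by boundary values,
  with \<open>0 < u 0\<close> and \<open>u T \<le> \<rho>\<close>, and by the integral of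
  \<open>u * M0 f\<close>, where monotonicity replaces \<open>M0 f s\<close> by its final
  value.\<close>

lemma integral_M\<beta>_le:
  assumes T: "T \<ge> 0"
  shows "b * integral {0..T} M\<beta> \<le> \<rho> + a * M0 f T * integral {0..T} u"
proof -
  have i1: "M\<beta> integrable_on {0..T}" and i2: "(\<lambda>s. u s * M0 f s) integrable_on {0..T}"
    by (intro integrable_continuous_real continuous_intros continuous_on_subset[OF M\<beta>_continuous]
        continuous_on_subset[OF u_continuous] continuous_on_subset[OF M0_continuous]; auto)+
  have "integral {0..T} (\<lambda>s. a * u s * M0 f s - b * M\<beta> s)
      = a * integral {0..T} (\<lambda>s. u s * M0 f s) - b * integral {0..T} M\<beta>"
    unfolding mult.assoc using i1 i2
    by (subst Henstock_Kurzweil_Integration.integral_diff) (auto intro!: integrable_on_mult_right)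
  then have "b * integral {0..T} M\<beta> = u T - u 0 + a * integral {0..T} (\<lambda>s. u s * M0 f s)"
    using u_integral[OF T] u_integral[of 0] by simp
  moreover have "integral {0..T} (\<lambda>s. u s * M0 f s) \<le> integral {0..T} (\<lambda>s. u s * M0 f T)"
  proof (rule integral_le[OF i2])
    show "(\<lambda>s. u s * M0 f T) integrable_on {0..T}" by (intro integrable_on_mult_left u_integrable)
    show "u s * M0 f s \<le> u s * M0 f T" if "s \<in> {0..T}" for s
      using that u_pos[of s] by (intro mult_left_mono M0_mono) auto
  qed
  then have "a * integral {0..T} (\<lambda>s. u s * M0 f s) \<le> a * (M0 f T * integral {0..T} u)"
    using a by (intro mult_left_mono) (simp_all add: mult.commute)
  ultimately show ?thesis using u_le[OF T] u_pos[of 0] by simp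
qed

lemma u_integral_nonneg: "0 \<le> integral {0..T} u"
  by (rule integral_nonneg[OF u_integrable]) (simp add: u_nonneg)

text \<open>The averaged mass estimate is applied at the length \<open>1 / M0 f T\<close>, which
  gives both of its terms the same factor \<open>M0 f T powr \<beta>\<close>.\<close>

lemma time_le_M0_powr_mult:
  obtains C where "C > 0" "\<And>T. T \<ge> 1 \<Longrightarrow> \<rho> * T \<le> C * M0 f T powr \<beta> * (1 + integral {0..T} u)"
proof
  \<comment> \<open>A positive lower bound for \<open>M0 f T\<close> valid for all
    \<open>T \<ge> 1\<close>; time 0 would not do, since \<open>M0 f 0\<close> may vanish.\<close>
  define m where "m = M0 f 1"
  have m: "m > 0" unfolding m_def by (rule M0_pos) simp
  \<comment> \<open>The second moment estimate at \<open>T = 0\<close>.\<close>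
  have M2: "0 \<le> M2_in"
    using integral_powr_cutoff_le[of 0 1] by simp
  \<comment> \<open>One summand for each of the five terms estimated below. Those with
    \<open>m\<close> come from \<open>1 \<le> N powr \<beta> * m powr (- \<beta>)\<close> and
    \<open>1 / N \<le> 1 / m\<close>.\<close>
  define C where "C = m powr (- \<beta>) + \<rho> / (b * m) + a / b + M2_in / b + a * \<rho> / b"
  show "C > 0" unfolding C_def using m M2 a b \<rho> by (intro add_pos_nonneg add_nonneg_nonneg) auto
  fix T :: real assume T: "T \<ge> 1"
  define N where "N = M0 f T"
  define U where "U = integral {0..T} u"
  have Nm: "m \<le> N" unfolding m_def N_def using T by (intro M0_mono) auto
  then have N: "N > 0" using m by simp
  have U: "U \<ge> 0" unfolding U_def by (rule u_integral_nonneg)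
  define P where "P = N powr \<beta>"
  have P: "P > 0" using N by (simp add: P_def)
  have "integral {0..T} M\<beta> \<le> (\<rho> + a * N * U) / b"
    using integral_M\<beta>_le[of T] T b by (simp add: N_def U_def pos_le_divide_eq mult.commute)
  then have "P / N * integral {0..T} M\<beta> \<le> P / N * ((\<rho> + a * N * U) / b)"
    using P N by (intro mult_left_mono) auto
  moreover have "(1 / N) powr (1 - \<beta>) = P / N" "(1 / N) powr (- \<beta>) = P"
    using N by (simp_all add: P_def powr_divide powr_diff powr_minus)
  ultimately have "\<rho> * T \<le> U + P / N * ((\<rho> + a * N * U) / b) + P * ((M2_in + a * \<rho> * U) / b)"
    using averaged_mass_le[of T "1 / N"] T N by (simp add: U_def)
  also have "\<dots> = U + P * (\<rho> / (b * N)) + P * U * (a / b) + P * (M2_in / b) + P * U * (a * \<rho> / b)"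
    using N b by (simp add: field_simps)
  also have "\<dots> \<le> P * U * m powr (- \<beta>) + P * (\<rho> / (b * m)) + P * U * (a / b) + P * (M2_in / b) + P * U * (a * \<rho> / b)"
  proof -
    have "m powr \<beta> \<le> P" unfolding P_def using m Nm \<beta>0 by (intro powr_mono2) auto
    then have "1 \<le> P * m powr (- \<beta>)" using m by (simp add: powr_minus field_simps)
    then have "U \<le> P * U * m powr (- \<beta>)" using mult_left_mono[OF _ U, of 1 "P * m powr (- \<beta>)"] by (simp add: mult_ac)
    moreover have "P * (\<rho> / (b * N)) \<le> P * (\<rho> / (b * m))"
      using P \<rho> b m Nm N by (intro mult_left_mono divide_left_mono) auto
    ultimately show ?thesis by simp
  qed
  also have "\<dots> \<le> P * (1 + U) * m powr (- \<beta>) + P * (1 + U) * (\<rho> / (b * m)) + P * (1 + U) * (a / b)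
      + P * (1 + U) * (M2_in / b) + P * (1 + U) * (a * \<rho> / b)"
    using P U m \<rho> a b M2 by (intro add_mono mult_right_mono) auto
  also have "\<dots> = C * P * (1 + U)" by (simp add: C_def algebra_simps add_divide_distrib)
  finally show "\<rho> * T \<le> C * M0 f T powr \<beta> * (1 + integral {0..T} u)" by (simp add: P_def N_def U_def)
qed

text \<open>Pointwise in time, either \<open>u s \<le> l\<close>, or \<open>u s / l\<close> exceeds
  1 and \<open>u s\<close> is at most \<open>u s ^ i0 / l ^ (i0 - 1)\<close>. The integral of
  \<open>u ^ i0\<close> is the increase of \<open>M0 f\<close>. The level \<open>l\<close> is left
  free for later optimisation.\<close>

lemma integral_u_le:
  assumes T: "T \<ge> 0" and l: "l > 0"
  shows "integral {0..T} u \<le> l * T + M0 f T / l ^ (i0 - 1)"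
proof -
  have pi: "(\<lambda>s. u s ^ i0) integrable_on {0..T}"
    by (intro integrable_continuous_real continuous_intros continuous_on_subset[OF u_continuous]) auto
  have "integral {0..T} u \<le> integral {0..T} (\<lambda>s. l + u s ^ i0 * (1 / l ^ (i0 - 1)))"
  proof (rule integral_le[OF u_integrable])
    show "(\<lambda>s. l + u s ^ i0 * (1 / l ^ (i0 - 1))) integrable_on {0..T}"
      by (intro integrable_add integrable_on_mult_left pi integrable_const_ivl)
    fix s assume "s \<in> {0..T}"
    then have us: "u s > 0" using u_pos by simp
    show "u s \<le> l + u s ^ i0 * (1 / l ^ (i0 - 1))"
    proof (cases "u s \<le> l")
      case True
      then show ?thesis using us l by (simp add: add_increasing2)
    next
      case False
      then have "u s * 1 \<le> u s * (u s / l) ^ (i0 - 1)"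
        using us l by (intro mult_left_mono one_le_power) auto
      also have "\<dots> = u s ^ i0 * (1 / l ^ (i0 - 1))"
        using i0 by (cases i0) (auto simp: power_divide)
      finally show ?thesis using l by simp
    qed
  qed
  also have "\<dots> = l * T + integral {0..T} (\<lambda>s. u s ^ i0) * (1 / l ^ (i0 - 1))"
    using T by (subst Henstock_Kurzweil_Integration.integral_add[OF integrable_const_ivl integrable_on_mult_left[OF pi]])
      simp
  also have "\<dots> \<le> l * T + M0 f T * (1 / l ^ (i0 - 1))"
  proof (intro add_left_mono mult_right_mono)
    show "integral {0..T} (\<lambda>s. u s ^ i0) \<le> M0 f T"
      using M0_integral[OF T] M0_integral[of 0] M0_nonneg[of 0] by simp
  qed (use l in auto)
  finally show ?thesis by simp
qed

text \<open>In the bound for \<open>\<rho> * T\<close>, the integral of \<open>u\<close> is split at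
  a level \<open>l\<close> so small that the part proportional to \<open>T\<close> uses up only half
  of the left side.\<close>

lemma M0_powr_lower:
  obtains c where "c > 0" "\<And>T. T \<ge> 1 \<Longrightarrow> c * T \<le> M0 f T powr (1 + real i0 * \<beta>)"
proof -
  obtain C where C: "C > 0" "\<And>T. T \<ge> 1 \<Longrightarrow> \<rho> * T \<le> C * M0 f T powr \<beta> * (1 + integral {0..T} u)"
    using time_le_M0_powr_mult by blast
  define m where "m = M0 f 1"
  have m: "m > 0" unfolding m_def by (rule M0_pos) simp
  \<comment> \<open>Chosen so that \<open>C * \<epsilon> * T\<close> is exactly
    \<open>\<rho> * T / 2\<close>.\<close>
  define \<epsilon> where "\<epsilon> = \<rho> / (2 * C)"
  have \<epsilon>: "\<epsilon> > 0" using C \<rho> by (simp add: \<epsilon>_def)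
  define e where "e = 1 + real i0 * \<beta>"
  have e: "\<beta> \<le> e" using \<beta>0 \<beta>1 by (simp add: e_def add_increasing2)
  define D where "D = C * m powr (\<beta> - e) + C / \<epsilon> ^ (i0 - 1)"
  have D: "D > 0" using C m \<epsilon> by (simp add: D_def add_pos_pos)
  have "\<rho> / (2 * D) * T \<le> M0 f T powr e" if T: "T \<ge> 1" for T
  proof -
    define N where "N = M0 f T"
    have Nm: "m \<le> N" unfolding m_def N_def using T by (intro M0_mono) auto
    then have N: "N > 0" using m by simp
    \<comment> \<open>This power cancels the prefactor \<open>N powr \<beta>\<close> in the term
      linear in \<open>T\<close>, and turns the other term into a multiple of
      \<open>N powr e\<close>, because \<open>\<beta> + 1 + (i0 - 1) * \<beta> = e\<close>.\<close>
    define l where "l = \<epsilon> * N powr (- \<beta>)"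
    have l: "l > 0" using \<epsilon> N by (simp add: l_def)
    have Pl: "N powr \<beta> * l = \<epsilon>" using N by (simp add: l_def powr_minus field_simps)
    have PN: "N powr \<beta> * (N / l ^ (i0 - 1)) = N powr e / \<epsilon> ^ (i0 - 1)"
    proof -
      have "l ^ (i0 - 1) = \<epsilon> ^ (i0 - 1) * N powr (- (real (i0 - 1) * \<beta>))"
        using N by (simp add: l_def power_mult_distrib powr_realpow[symmetric] powr_powr mult.commute)
      moreover have "N powr \<beta> * N * N powr (real (i0 - 1) * \<beta>) = N powr e"
      proof -
        have "N powr \<beta> * N powr 1 * N powr (real (i0 - 1) * \<beta>) = N powr (\<beta> + 1 + real (i0 - 1) * \<beta>)"
          by (simp only: powr_add)
        also have "\<beta> + 1 + real (i0 - 1) * \<beta> = e" using i0 by (simp add: e_def of_nat_diff algebra_simps)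
        finally show ?thesis using N by simp
      qed
      ultimately show ?thesis using N by (simp add: powr_minus divide_inverse mult_ac)
    qed
    have "\<rho> * T \<le> C * N powr \<beta> * (1 + integral {0..T} u)"
      using C(2)[OF T] by (simp add: N_def)
    also have "\<dots> \<le> C * N powr \<beta> * (1 + (l * T + N / l ^ (i0 - 1)))"
      unfolding N_def using integral_u_le[OF _ l, of T] T C(1)
      by (intro mult_left_mono add_left_mono) auto
    also have "\<dots> = C * N powr \<beta> + C * (N powr \<beta> * l) * T + C * (N powr \<beta> * (N / l ^ (i0 - 1)))"
      by (simp add: algebra_simps)
    also have "\<dots> = C * N powr \<beta> + \<rho> * T / 2 + C / \<epsilon> ^ (i0 - 1) * N powr e"
      unfolding Pl PN using C(1) by (simp add: \<epsilon>_def)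
    finally have "\<rho> * T / 2 \<le> C * N powr \<beta> + C / \<epsilon> ^ (i0 - 1) * N powr e"
      by linarith
    \<comment> \<open>The lower power of \<open>N\<close> is absorbed into the higher one, using
      \<open>\<beta> \<le> e\<close> and \<open>m \<le> N\<close>.\<close>
    moreover have "C * N powr \<beta> \<le> C * (m powr (\<beta> - e) * N powr e)"
    proof (rule mult_left_mono)
      have "N powr (\<beta> - e) \<le> m powr (\<beta> - e)" using e m Nm by (intro powr_mono2') auto
      then have "N powr (\<beta> - e) * N powr e \<le> m powr (\<beta> - e) * N powr e" by (rule mult_right_mono) simp
      then show "N powr \<beta> \<le> m powr (\<beta> - e) * N powr e" by (simp flip: powr_add)
    qed (use C(1) in simp)
    ultimately have "\<rho> * T / 2 \<le> D * N powr e"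
      unfolding D_def distrib_right mult.assoc by linarith
    then show ?thesis using D by (simp add: N_def field_simps)
  qed
  then show thesis using that[of "\<rho> / (2 * D)"] D \<rho> by (simp add: e_def)
qed

section \<open>Boundedness of the rescaled product and the decay rates\<close>

text \<open>The derivative of the product consists of a gain from \<open>M\<beta>\<close>, a damping
  term and a nucleation term. Half of the damping absorbs the nucleation term once
  \<open>M0 f\<close> is large, which \<open>M0_powr_lower\<close> guarantees; the rest is a barrier
  argument.\<close>

lemma M0_powr_mult_u_bounded:
  obtains t0 K where "t0 \<ge> 1" "K > 0" "\<And>t. t \<ge> t0 \<Longrightarrow> M0 f t powr \<beta> * u t \<le> K"
proof -
  define e where "e = 1 + real i0 * \<beta>"
  have e: "e > 0" using \<beta>0 by (simp add: e_def add_pos_nonneg)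
  obtain c where c: "c > 0" "\<And>T. T \<ge> 1 \<Longrightarrow> c * T \<le> M0 f T powr e"
    using M0_powr_lower unfolding e_def by blast
  \<comment> \<open>The size of \<open>M0 f\<close> at which \<open>\<beta> * \<rho> ^ i0\<close>
    equals \<open>a / 2\<close> times its square.\<close>
  define m where "m = sqrt (2 * \<beta> * \<rho> ^ i0 / a)"
  have m: "m > 0" using \<beta>0 \<rho> a by (simp add: m_def)
  \<comment> \<open>From this time on, the lower bound forces \<open>M0 f t \<ge> m\<close>; the
    entry 1 reflects its range of validity.\<close>
  define t0 where "t0 = max 1 (m powr e / c)"
  have t0: "t0 \<ge> 1" by (simp add: t0_def)
  have M0_large: "\<beta> * \<rho> ^ i0 \<le> a / 2 * (M0 f t)\<^sup>2" if "t \<ge> t0" for t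
  proof -
    have "m powr e \<le> c * t0" using c(1) by (simp add: t0_def max_def field_simps)
    also have "\<dots> \<le> M0 f t0 powr e" by (rule c(2)[OF t0])
    finally have "m \<le> M0 f t0"
      using powr_less_mono2[OF e, of "M0 f t0" m] M0_nonneg[of t0] t0 by force
    also have "\<dots> \<le> M0 f t" using t0 that by (intro M0_mono) auto
    finally have "m\<^sup>2 \<le> (M0 f t)\<^sup>2" using m by (intro power_mono) auto
    moreover have "m\<^sup>2 = 2 * \<beta> * \<rho> ^ i0 / a"
      unfolding m_def using \<beta>0 \<rho> a by (intro real_sqrt_pow2) auto
    ultimately show ?thesis using a by (simp add: field_simps)
  qed
  define w where "w = (\<lambda>t. M0 f t powr \<beta> * u t)"
  define w' where "w' = (\<lambda>t. M0 f t powr \<beta> * (b * M\<beta> t - a * u t * M0 f t)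
      + \<beta> * M0 f t powr (\<beta> - 1) * u t ^ i0 * u t)"
  \<comment> \<open>The constant in the gain term: by \<open>M\<beta>_le\<close> the powers of
    \<open>M0 f t\<close> combine to exponent 1.\<close>
  define B where "B = b * (1 + \<rho>)"
  have B: "B > 0" using b \<rho> by (simp add: B_def)
  have w_deriv: "(w has_real_derivative w' t) (at t)" if "t \<ge> t0" for t
    using DERIV_mult[OF DERIV_fun_powr[OF M0_deriv, of t \<beta>] u_deriv[of t]] M0_pos[of t] that t0
    by (simp add: w_def w'_def algebra_simps)
  have w'_le: "w' t \<le> M0 f t * (B - a / 2 * w t)" if "t \<ge> t0" for t
  proof -
    let ?N = "M0 f t"
    have t: "t > 0" using that t0 by simp
    have N: "?N > 0" by (rule M0_pos[OF t])
    have ut: "0 < u t" "u t \<le> \<rho>" using t u_pos u_le by auto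
    have "?N powr \<beta> * (b * M\<beta> t) \<le> ?N powr \<beta> * (b * ((1 + \<rho>) * ?N powr (1 - \<beta>)))"
      using b M\<beta>_le[OF t] by (intro mult_left_mono) auto
    also have "\<dots> = B * ?N" using N by (simp add: B_def powr_diff)
    finally have 1: "?N powr \<beta> * (b * M\<beta> t) \<le> B * ?N" .
    \<comment> \<open>Nucleation term: after multiplication by
      \<open>?N powr (\<beta> - 1) * u t\<close>, the factor \<open>?N\<^sup>2\<close> produces
      \<open>w t * ?N\<close>, that is, half of the damping.\<close>
    have "\<beta> * u t ^ i0 \<le> \<beta> * \<rho> ^ i0" using ut \<beta>0 by (intro mult_left_mono power_mono) auto
    also have "\<dots> \<le> a / 2 * ?N\<^sup>2" by (rule M0_large[OF that])
    finally have "(\<beta> * u t ^ i0) * (?N powr (\<beta> - 1) * u t) \<le> (a / 2 * ?N\<^sup>2) * (?N powr (\<beta> - 1) * u t)"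
      using ut by (intro mult_right_mono) auto
    also have "\<dots> = a / 2 * w t * ?N"
      using N by (simp add: w_def powr_diff power2_eq_square)
    finally have 2: "\<beta> * ?N powr (\<beta> - 1) * u t ^ i0 * u t \<le> a / 2 * w t * ?N"
      by (simp add: mult_ac)
    show ?thesis using 1 2 unfolding w'_def by (simp add: algebra_simps w_def)
  qed
  \<comment> \<open>Above \<open>2 * B / a\<close> the factor \<open>B - a / 2 * w t\<close> is
    negative; the other entry covers the starting value.\<close>
  define K where "K = max (w t0) (2 * B / a)"
  have K: "K > 0" using B a by (auto simp: K_def less_max_iff_disj)
  have "w t \<le> K" if "t \<ge> t0" for t
  proof (rule le_of_deriv_neg_above[OF w_deriv _ _ that])
    show "w t0 \<le> K" by (simp add: K_def)
    fix s assume s: "s \<ge> t0" "w s > K"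
    have "w s > 2 * B / a" using s(2) unfolding K_def by (rule le_less_trans[rotated]) simp
    then have "B - a / 2 * w s < 0" using a by (simp add: field_simps)
    then have "M0 f s * (B - a / 2 * w s) < 0"
      using M0_pos[of s] s(1) t0 by (intro mult_pos_neg) auto
    then show "w' s < 0" using w'_le[OF s(1)] by linarith
  qed
  then show thesis using that t0 K by (simp add: w_def)
qed

text \<open>Since \<open>e - 1 = i0 * \<beta>\<close>, the derivative of
  \<open>M0 f t powr e\<close> is \<open>e\<close> times the \<open>i0\<close>-th power of the
  bounded product.\<close>

lemma M0_powr_upper:
  obtains t1 D where "t1 \<ge> 1" "D > 0" "\<And>t. t \<ge> t1 \<Longrightarrow> M0 f t powr (1 + real i0 * \<beta>) \<le> D * t"
proof -
  define e where "e = 1 + real i0 * \<beta>"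
  obtain t0 K where t0: "t0 \<ge> 1" and K: "K > 0" "\<And>t. t \<ge> t0 \<Longrightarrow> M0 f t powr \<beta> * u t \<le> K"
    using M0_powr_mult_u_bounded by blast
  define E where "E = e * K ^ i0"
  have e: "e \<ge> 1" using \<beta>0 by (simp add: e_def)
  have E: "E > 0" using e K by (simp add: E_def)
  \<comment> \<open>The starting value at \<open>t0\<close> is absorbed into the slope because
    \<open>t \<ge> 1\<close>.\<close>
  define D where "D = E + M0 f t0 powr e"
  have "M0 f t powr e \<le> D * t" if t: "t \<ge> t0" for t
  proof -
    have "E * t0 - M0 f t0 powr e \<le> E * t - M0 f t powr e"
    proof (rule DERIV_nonneg_imp_nondecreasing[OF t])
      fix s assume s: "t0 \<le> s" "s \<le> t"
      then have s0: "s > 0" using t0 by simp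
      have "((\<lambda>s. E * s - M0 f s powr e) has_real_derivative E - e * M0 f s powr (e - 1) * u s ^ i0) (at s)"
        using DERIV_diff[OF DERIV_cmult[OF DERIV_ident, of E] DERIV_fun_powr[OF M0_deriv[OF s0] M0_pos[OF s0], of e]]
        by simp
      moreover have "e * M0 f s powr (e - 1) * u s ^ i0 \<le> E"
      proof -
        have "M0 f s powr (e - 1) * u s ^ i0 = (M0 f s powr \<beta> * u s) ^ i0"
          using M0_pos[OF s0] by (simp add: e_def power_mult_distrib powr_powr powr_realpow[symmetric] mult.commute)
        also have "\<dots> \<le> K ^ i0"
          using K(2)[OF s(1)] u_pos[of s] s0 by (intro power_mono) auto
        finally show ?thesis using e by (simp add: E_def mult.assoc)
      qed
      ultimately show "\<exists>y. ((\<lambda>s. E * s - M0 f s powr e) has_real_derivative y) (at s) \<and> 0 \<le> y"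
        by (intro exI conjI) auto
    qed
    moreover have "0 \<le> E * t0" using E t0 by simp
    moreover have "M0 f t0 powr e * 1 \<le> M0 f t0 powr e * t" using t t0 by (intro mult_left_mono) auto
    ultimately show ?thesis by (simp add: D_def distrib_right)
  qed
  moreover have "D > 0" using E by (simp add: D_def add_pos_nonneg)
  ultimately show thesis using that t0 by (simp add: e_def)
qed

lemma decay_rates:
  "\<exists>C>0. \<forall>\<^sub>F t in at_top.
     M0 f t \<le> C * t powr (1 / (1 + real i0 * \<beta>)) \<and>
     u t \<le> C * t powr (- \<beta> / (1 + real i0 * \<beta>))"
proof -
  define e where "e = 1 + real i0 * \<beta>"
  have e: "e > 0" using \<beta>0 by (simp add: e_def add_pos_nonneg)
  obtain c where c: "c > 0" "\<And>T. T \<ge> 1 \<Longrightarrow> c * T \<le> M0 f T powr e"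
    using M0_powr_lower unfolding e_def by blast
  obtain t0 K where t0: "t0 \<ge> 1" and K: "K > 0" "\<And>t. t \<ge> t0 \<Longrightarrow> M0 f t powr \<beta> * u t \<le> K"
    using M0_powr_mult_u_bounded by blast
  obtain t1 D where t1: "t1 \<ge> 1" and D: "D > 0" "\<And>t. t \<ge> t1 \<Longrightarrow> M0 f t powr e \<le> D * t"
    using M0_powr_upper unfolding e_def by blast
  \<comment> \<open>The first entry serves \<open>M0 f\<close>, the second \<open>u\<close>.\<close>
  define C where "C = max (D powr (1 / e)) (K * c powr (- \<beta> / e))"
  have bounds: "M0 f t \<le> C * t powr (1 / e) \<and> u t \<le> C * t powr (- \<beta> / e)" if "t \<ge> max t0 t1" for t
  proof
    let ?N = "M0 f t"
    have t: "t \<ge> t0" "t \<ge> t1" "t \<ge> 1" using that t0 by auto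
    have N: "?N > 0" using M0_pos t by simp
    have "?N = (?N powr e) powr (1 / e)" using N e by (simp add: powr_powr)
    also have "\<dots> \<le> (D * t) powr (1 / e)" using D(2)[OF t(2)] e by (intro powr_mono2) auto
    also have "\<dots> = D powr (1 / e) * t powr (1 / e)" using D t by (simp add: powr_mult)
    also have "\<dots> \<le> C * t powr (1 / e)" by (intro mult_right_mono) (auto simp: C_def)
    finally show "?N \<le> C * t powr (1 / e)" .
    have "u t = (?N powr \<beta> * u t) * ?N powr (- \<beta>)" using N by (simp add: powr_minus field_simps)
    also have "\<dots> \<le> K * ?N powr (- \<beta>)" using K(2)[OF t(1)] by (intro mult_right_mono) auto
    also have "?N powr (- \<beta>) = (?N powr e) powr (- \<beta> / e)" using N e by (simp add: powr_powr)
    \<comment> \<open>The exponent is negative, so the lower bound for \<open>M0 f\<close> becomes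
      an upper bound here.\<close>
    also have "\<dots> \<le> (c * t) powr (- \<beta> / e)"
      using c(1) c(2)[OF t(3)] t(3) \<beta>0 e by (intro powr_mono2') (auto simp: divide_nonpos_pos)
    also have "\<dots> = c powr (- \<beta> / e) * t powr (- \<beta> / e)" using c t by (simp add: powr_mult)
    finally have "u t \<le> K * c powr (- \<beta> / e) * t powr (- \<beta> / e)" using K(1) by (simp add: mult.assoc)
    also have "\<dots> \<le> C * t powr (- \<beta> / e)" by (intro mult_right_mono) (auto simp: C_def)
    finally show "u t \<le> C * t powr (- \<beta> / e)" .
  qed
  have "C > 0" using D(1) by (simp add: C_def less_max_iff_disj)
  then show ?thesis using bounds unfolding e_def[symmetric] eventually_at_top_linorder by blast
qed

end

theorem lemma5p1:
  fixes a b \<beta> \<rho> :: real and i0 :: nat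
    and f_in :: "real \<Rightarrow> real" and f :: "real \<Rightarrow> real \<Rightarrow> real"
  assumes "a > 0" and "b > 0" and "0 < \<beta>" and "\<beta> \<le> 1" and "i0 \<ge> 1" and "\<rho> > 0"
    and "f_in \<in> weighted_L1" and "nonneg_ae f_in"
    and "set_integrable lebesgue {0<..} (\<lambda>x. x\<^sup>2 * f_in x)"
    and "global_solution (\<lambda>x. a) (\<lambda>x. b * x powr \<beta>) (\<lambda>z. z ^ i0) f_in \<rho> f"
  shows "\<exists>C>0. \<forall>\<^sub>F t in at_top.
           M0 f t \<le> C * t powr (1 / (1 + real i0 * \<beta>)) \<and>
           monomer \<rho> f t \<le> C * t powr (- \<beta> / (1 + real i0 * \<beta>))"
  using assms by (intro lifshitz_slyozov.decay_rates lifshitz_slyozov.intro)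

end
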